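(* Consider the Randomized Round-Robin protocol with $n$ agents over a finite item set $M$, as described in the context, and let $\mathrm{OPT}_i=\max_{S\in\mathcal{I}_i}f_i(S)$. Assume agent $i$ chooses greedily (the greedy policy if $f_i$ is monotone, the simultaneous greedy policy if $f_i$ is non-monotone), the other agents following arbitrary policies. Then the expected value agent $i$ obtains (from the best of the solutions it builds), over the random permutation, is at least $\mathrm{OPT}_i/(\beta n)$, where: $\beta=2+p_i/n$ if $\mathcal{I}_i$ is a $p_i$-system and $f_i$ is monotone submodular; $\beta=2$ if $\mathcal{I}_i$ is a cardinality constraint and $f_i$ is monotone submodular; $\beta=5+(4p_i+2)/n$ if $\mathcal{I}_i$ is a $p_i$-system and $f_i$ is non-monotone submodular; $\beta=5+2/n$ if $\mathcal{I}_i$ is a cardinality constraint and $f_i$ is non-monotone submodular.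
   Context: Each agent $i\in[n]$ has a normalized ($f_i(\emptyset)=0$), nonnegative submodular $f_i:2^M\to\mathbb{R}_{\ge0}$ and constraint $\mathcal{I}_i$. Write $f(x\,|\,S)=f(S\cup\{x\})-f(S)$. An independence system is a family $\mathcal{I}\subseteq 2^M$ containing $\emptyset$ and closed under subsets; a basis of $S$ is a maximal member of $\mathcal{I}$ contained in $S$; $\mathrm{ur}(S)$, $\mathrm{lr}(S)$ are the largest and smallest basis cardinalities of $S$; a $p$-system is an independence system with $\max_{S\subseteq M}\mathrm{ur}(S)/\mathrm{lr}(S)\le p$. A cardinality constraint is $\{S\subseteq M:|S|\le k\}$. Randomized Round-Robin protocol: draw a uniformly random permutation $\pi$ of $[n]$; initially the available set is $Q=M$, $|M|=m$; for rounds $r=1,\dots,\lceil m/n\rceil$ and within each round for $\ell=1,\dots,n$, agent $\pi(\ell)$ (by its policy, possibly using full information) either selects one item of $Q$, which is removed from $Q$, or selects nothing. Greedy policy of agent $i$: maintain $S_i$ (initially $\emptyset$); at each turn let $A=\{x\in Q: S_i\cup\{x\}\in\mathcal{I}_i\}$; if $A\neq\emptyset$ select some $j\in\arg\max_{x\in A}f_i(x\,|\,S_i)$ and add it to $S_i$, otherwise nothing. Simultaneous greedy policy: maintain $S_{i1},S_{i2}$ (initially empty); at each turn let $A=\{(x,y)\in Q\times\{1,2\}: S_{iy}\cup\{x\}\in\mathcal{I}_i\}$; if $A\ne\emptyset$ pick $(j,\ell)\in\arg\max_{(z,w)\in A} f_i(z\,|\,S_{iw})$, select $j$ and add it to $S_{i\ell}$;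 otherwise nothing.
   Formalization: The value obtained is the best value of any solution at any stage of the protocol, not only of the final solutions; for non-monotone functions the claim for the final solutions fails, since the simultaneous greedy policy also selects items of negative marginal value. *)

theory Defs
  imports "HOL-Probability.Probability" "HOL-Combinatorics.Permutations"
begin

section \<open>Submodular functions and independence systems on a ground set\<close>

definition marginal :: "('a set \<Rightarrow> real) \<Rightarrow> 'a \<Rightarrow> 'a set \<Rightarrow> real" where
  "marginal f x S = f (S \<union> {x}) - f S"

definition submodular_on :: "'a set \<Rightarrow> ('a set \<Rightarrow> real) \<Rightarrow> bool" where
  "submodular_on M f \<longleftrightarrow>
     (\<forall>S T. S \<subseteq> M \<longrightarrow> T \<subseteq> M \<longrightarrow> f (S \<union> T) + f (S \<inter> T) \<le> f S + f T)"

definition independence_system :: "'a set \<Rightarrow> 'a set set \<Rightarrow> bool" where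
  "independence_system M \<I> \<longleftrightarrow>
     \<I> \<subseteq> Pow M \<and> {} \<in> \<I> \<and> (\<forall>S\<in>\<I>. \<forall>T. T \<subseteq> S \<longrightarrow> T \<in> \<I>)"

definition bases :: "'a set set \<Rightarrow> 'a set \<Rightarrow> 'a set set" where
  "bases \<I> S = {B \<in> \<I>. B \<subseteq> S \<and> (\<forall>C\<in>\<I>. B \<subseteq> C \<and> C \<subseteq> S \<longrightarrow> C = B)}"

definition upper_rank :: "'a set set \<Rightarrow> 'a set \<Rightarrow> nat" where
  "upper_rank \<I> S = Max (card ` bases \<I> S)"

definition lower_rank :: "'a set set \<Rightarrow> 'a set \<Rightarrow> nat" where
  "lower_rank \<I> S = Min (card ` bases \<I> S)"

text \<open>The lower rank of \<open>S\<close> vanishes only if the upper rank does too (for example for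
  \<open>S = {}\<close>); the quotient is then \<open>0 / 0 = 0\<close>, so such an \<open>S\<close> does not constrain \<open>p\<close>
  beyond \<open>p \<ge> 0\<close>.\<close>

definition p_system :: "'a set \<Rightarrow> 'a set set \<Rightarrow> real \<Rightarrow> bool" where
  "p_system M \<I> p \<longleftrightarrow> independence_system M \<I> \<and>
     Max ((\<lambda>S. real (upper_rank \<I> S) / real (lower_rank \<I> S)) ` Pow M) \<le> p"

definition cardinality_constraint :: "'a set \<Rightarrow> nat \<Rightarrow> 'a set set" where
  "cardinality_constraint M k = {S. S \<subseteq> M \<and> card S \<le> k}"

definition OPT :: "'a set set \<Rightarrow> ('a set \<Rightarrow> real) \<Rightarrow> real" where
  "OPT \<I> f = Max (f ` \<I>)"


section \<open>The Round-Robin protocol\<close>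

text \<open>A move is \<open>None\<close> (nothing is selected) or \<open>Some (x, y)\<close>: item \<open>x\<close> is selected and the
  selecting agent adds it to the solution it maintains under label \<open>y\<close>. Labels carry no
  meaning for the protocol; they only record the agent's internal bookkeeping. A history lists
  the agents that moved, in order, with their moves. Policies see the whole permutation and
  the whole history, and since they are quantified after all other data they may depend on
  that data as well.\<close>

type_synonym 'a move = "('a \<times> nat) option"
type_synonym 'a history = "(nat \<times> 'a move) list"
type_synonym 'a policy = "(nat \<Rightarrow> nat) \<Rightarrow> 'a history \<Rightarrow> 'a move"

definition available :: "'a set \<Rightarrow> 'a history \<Rightarrow> 'a set" where
  "available M h = M - {x. \<exists>j y. (j, Some (x, y)) \<in> set h}"

definition solution :: "nat \<Rightarrow> nat \<Rightarrow> 'a history \<Rightarrow> 'a set" where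
  "solution i y h = {x. (i, Some (x, y)) \<in> set h}"

definition legal_policy :: "'a set \<Rightarrow> 'a policy \<Rightarrow> bool" where
  "legal_policy M Q \<longleftrightarrow> (\<forall>\<pi> h x y. Q \<pi> h = Some (x, y) \<longrightarrow> x \<in> available M h)"

definition turn_order :: "'a set \<Rightarrow> nat \<Rightarrow> (nat \<Rightarrow> nat) \<Rightarrow> nat list" where
  "turn_order M n \<pi> =
     concat (replicate (nat \<lceil>real (card M) / real n\<rceil>) (map \<pi> [1..<Suc n]))"

definition round_robin ::
    "'a set \<Rightarrow> nat \<Rightarrow> (nat \<Rightarrow> 'a policy) \<Rightarrow> (nat \<Rightarrow> nat) \<Rightarrow> 'a history" where
  "round_robin M n P \<pi> = fold (\<lambda>j h. h @ [(j, P j \<pi> h)]) (turn_order M n \<pi>) []"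


section \<open>Greedy agents\<close>

definition candidates ::
    "'a set \<Rightarrow> 'a set set \<Rightarrow> nat set \<Rightarrow> nat \<Rightarrow> 'a history \<Rightarrow> ('a \<times> nat) set" where
  "candidates M \<I> Y i h =
     {(x, y). x \<in> available M h \<and> y \<in> Y \<and> solution i y h \<union> {x} \<in> \<I>}"

text \<open>Greedy selection into the family of solutions labelled by \<open>Y\<close>. Ties are broken
  arbitrarily, and a candidate is selected even if its marginal value is negative.\<close>

definition greedy_into ::
    "nat set \<Rightarrow> 'a set \<Rightarrow> 'a set set \<Rightarrow> ('a set \<Rightarrow> real) \<Rightarrow> nat \<Rightarrow> 'a policy \<Rightarrow> bool" where
  "greedy_into Y M \<I> f i Q \<longleftrightarrow> (\<forall>\<pi> h.
     (if candidates M \<I> Y i h = {} then Q \<pi> h = None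
      else \<exists>c. Q \<pi> h = Some c \<and>
             is_arg_max (\<lambda>(x, y). marginal f x (solution i y h))
               (\<lambda>c. c \<in> candidates M \<I> Y i h) c))"

text \<open>One solution (the greedy policy) for monotone \<open>f\<close>, two (the simultaneous greedy policy)
  for non-monotone \<open>f\<close>.\<close>

definition labels :: "'a set \<Rightarrow> ('a set \<Rightarrow> real) \<Rightarrow> nat set" where
  "labels M f = (if mono_on (Pow M) f then {1} else {1, 2})"

definition chooses_greedily ::
    "'a set \<Rightarrow> 'a set set \<Rightarrow> ('a set \<Rightarrow> real) \<Rightarrow> nat \<Rightarrow> 'a policy \<Rightarrow> bool" where
  "chooses_greedily M \<I> f i Q \<longleftrightarrow> greedy_into (labels M f) M \<I> f i Q"

text \<open>The best of the solutions an agent builds is taken over its labels and over all stages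
  of the protocol. For monotone \<open>f\<close> this is the value of the final solution. For non-monotone
  \<open>f\<close> the stages matter, because the policy also selects items of negative marginal value:
  take one agent, items \<open>y, z, z', x\<close>, solutions of size at most 2, and \<open>f S = 1\<close> if
  \<open>y \<in> S \<and> x \<notin> S\<close>, \<open>f S = 0\<close> otherwise. Then \<open>y\<close> may go to the first solution, \<open>z\<close> and
  \<open>z'\<close> to the second, and finally \<open>x\<close> must go to the first, so both final values are 0.\<close>

definition obtained_value ::
    "nat set \<Rightarrow> ('a set \<Rightarrow> real) \<Rightarrow> nat \<Rightarrow> 'a history \<Rightarrow> real" where
  "obtained_value Y f i h =
     Max {f (solution i y (take t h)) | y t. y \<in> Y \<and> t \<le> length h}"

definition expected_value ::
    "'a set \<Rightarrow> nat \<Rightarrow> (nat \<Rightarrow> 'a policy) \<Rightarrow> ('a set \<Rightarrow> real) \<Rightarrow> nat \<Rightarrow> real" where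
  "expected_value M n P f i =
     measure_pmf.expectation (pmf_of_set {\<pi>. \<pi> permutes {1..n}})
       (\<lambda>\<pi>. obtained_value (labels M f) f i (round_robin M n P \<pi>))"

end

theory Submission imports Defs
begin

text \<open>Let \<open>D\<close> be an optimal set and \<open>a\<^sub>0 \<ge> a\<^sub>1 \<ge> \<dots>\<close> the values of its singletons, padded with
  zeros. Fix a permutation in which agent \<open>i\<close> has position \<open>c\<close> (counted from 0), and let \<open>V\<close> be
  the value it obtains. At most \<open>c\<close> items are lost before its first turn, so \<open>V \<ge> a\<^sub>c\<close>, and the
  lost part of \<open>D\<close> is worth at most \<open>a\<^sub>0 + \<dots> + a\<^sub>n\<^sub>-\<^sub>2\<close>. The remaining part \<open>U\<close> is compared with
  the greedy picks of nonnegative gain. A pair of an item of \<open>U\<close> and one of the \<open>q\<close> solutions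
  stops being a candidate because another agent took the item, because the agent put it in
  another solution, or because the solution blocks it; this happens to at most \<open>K r\<close> pairs before
  turn \<open>r\<close> (counted from 0), where \<open>K = q n - 1 + p\<close> in general and \<open>K = max (n - 1) 1\<close> for one
  solution and a cardinality constraint. As the gains decrease, summation by parts bounds the
  marginal values of all pairs by \<open>K\<close> times the total gain, whence \<open>f U \<le> (1 + K) q V\<close>.
  The position \<open>c\<close> is uniform, so averaging \<open>V \<ge> a\<^sub>c\<close> yields \<open>a\<^sub>0 + \<dots> + a\<^sub>n\<^sub>-\<^sub>1 \<le> n E V\<close>, and
  altogether \<open>OPT \<le> ((1 + K) q + n) E V\<close>; for \<open>n = 1\<close> nothing is lost and the last \<open>n\<close> disappears.\<close>

section \<open>Submodular functions and sums\<close>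

lemma marginal_antimono:
  assumes "submodular_on M f" "S \<subseteq> T" "T \<subseteq> M" "x \<in> M" "x \<notin> T"
  shows "marginal f x T \<le> marginal f x S"
proof -
  have "f (insert x S \<union> T) + f (insert x S \<inter> T) \<le> f (insert x S) + f T"
    using assms unfolding submodular_on_def by (metis insert_subset order_trans)
  moreover have "insert x S \<union> T = insert x T" "insert x S \<inter> T = S"
    using assms by auto
  ultimately show ?thesis by (simp add: marginal_def)
qed

text \<open>The items of \<open>D\<close> are added one at a time; by diminishing returns each
  contributes at most its marginal value with respect to \<open>S\<close>.\<close>

lemma submodular_union_le_sum_marginals:
  assumes "submodular_on M f" "finite D" "D \<subseteq> M" "S \<subseteq> M"
  shows "f (D \<union> S) \<le> f S + (\<Sum>x\<in>D - S. marginal f x S)"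
  using assms(2,3)
proof (induction D rule: finite_induct)
  case empty
  then show ?case by simp
next
  case (insert x D)
  show ?case
  proof (cases "x \<in> S")
    case True
    then have "insert x D \<union> S = D \<union> S" "insert x D - S = D - S" by auto
    then show ?thesis using insert by simp
  next
    case False
    then have eq: "insert x D - S = insert x (D - S)" by auto
    have "marginal f x (D \<union> S) \<le> marginal f x S"
      using insert.hyps insert.prems False assms by (intro marginal_antimono[of M]) auto
    then have "f (insert x D \<union> S) \<le> f (D \<union> S) + marginal f x S"
      by (simp add: marginal_def)
    moreover have "(\<Sum>z\<in>insert x D - S. marginal f z S)
        = marginal f x S + (\<Sum>z\<in>D - S. marginal f z S)"
      using insert.hyps by (simp add: eq)
    ultimately show ?thesis using insert by simp
  qed
qed

lemma submodular_le_sum_singletons: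
  assumes "submodular_on M f" "f {} = 0" "finite D" "D \<subseteq> M"
  shows "f D \<le> (\<Sum>x\<in>D. f {x})"
  using submodular_union_le_sum_marginals[OF assms(1,3,4), of "{}"] assms(2)
  by (simp add: marginal_def)

text \<open>The largest element \<open>b\<close> of a nonempty \<open>J\<close> is at least
  \<open>card J - 1\<close>, so exchanging it for that index cannot decrease the sum.\<close>

lemma sum_le_sum_initial_segment:
  fixes a :: "nat \<Rightarrow> real"
  assumes "finite J" "antimono a"
  shows "sum a J \<le> sum a {..<card J}"
  using assms(1)
proof (induction "card J" arbitrary: J)
  case 0
  then show ?case by simp
next
  case (Suc k)
  then have ne: "J \<noteq> {}" by auto
  define b where "b = Max J"
  have b: "b \<in> J" using Suc ne by (simp add: b_def)
  have "J \<subseteq> {..b}" using Suc ne by (auto simp: b_def)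
  then have "card J \<le> Suc b" by (metis card_atMost card_mono finite_atMost)
  then have "a b \<le> a k" using Suc assms(2) by (auto simp: antimono_def)
  moreover have "card (J - {b}) = k" using Suc b by simp
  then have "sum a (J - {b}) \<le> sum a {..<k}" using Suc by force
  moreover have "sum a J = a b + sum a (J - {b})" using Suc b by (simp add: sum.remove)
  ultimately show ?case by (simp flip: Suc(2))
qed

text \<open>Summation by parts, as an induction. The lower bound \<open>d\<close> and the slack term
  \<open>(K * real s - b s) * d\<close> strengthen the claim: the step uses the induction hypothesis
  with \<open>\<delta> s\<close> for \<open>d\<close>. The application takes
  \<open>d = 0\<close>.\<close>

lemma abel_sum_bound:
  fixes b \<delta> :: "nat \<Rightarrow> real"
  assumes "b 0 = 0" "\<And>r. r \<le> s \<Longrightarrow> b r \<le> K * real r"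
    and "\<And>r. r < s \<Longrightarrow> d \<le> \<delta> r" "0 \<le> d" "\<And>r. Suc r < s \<Longrightarrow> \<delta> (Suc r) \<le> \<delta> r"
  shows "(\<Sum>r<s. (b (Suc r) - b r) * \<delta> r) + (K * real s - b s) * d \<le> K * (\<Sum>r<s. \<delta> r)"
  using assms(2-)
proof (induction s arbitrary: d)
  case 0
  then show ?case using assms(1) by simp
next
  case (Suc s)
  have "\<delta> s \<le> \<delta> r" if "r < s" for r
    using that
  proof (induction rule: strict_inc_induct)
    case (base j)
    then show ?case using Suc.prems(4) by simp
  next
    case (step j)
    then show ?case using Suc.prems(4)[of j] by simp
  qed
  moreover have "0 \<le> \<delta> s" using Suc.prems(2)[of s] Suc.prems(3) by simp
  ultimately have "(\<Sum>r<s. (b (Suc r) - b r) * \<delta> r) + (K * real s - b s) * \<delta> s \<le> K * (\<Sum>r<s. \<delta> r)"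
    using Suc.prems by (intro Suc.IH) auto
  moreover have "(K * real (Suc s) - b (Suc s)) * d \<le> (K * real (Suc s) - b (Suc s)) * \<delta> s"
    using Suc.prems(1)[of "Suc s"] Suc.prems(2)[of s] by (intro mult_left_mono) auto
  ultimately show ?case by (simp add: algebra_simps)
qed

section \<open>Runs of the greedy rule with a shrinking supply\<close>

text \<open>\<open>A r\<close> is the set of available items at turn \<open>r\<close>, and \<open>s\<close> is the number of picks taken into
  account: the run is cut off before the first pick of negative gain.\<close>

locale greedy_run =
  fixes M :: "'a set" and \<I> :: "'a set set" and f :: "'a set \<Rightarrow> real" and Y :: "nat set"
    and A :: "nat \<Rightarrow> 'a set" and Sol :: "nat \<Rightarrow> nat \<Rightarrow> 'a set"
    and x :: "nat \<Rightarrow> 'a" and l :: "nat \<Rightarrow> nat" and s :: nat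
  assumes finite_M: "finite M" and finite_Y: "finite Y" and Y_nonempty: "Y \<noteq> {}"
    and normalized: "f {} = 0" and nonneg: "\<And>S. S \<subseteq> M \<Longrightarrow> 0 \<le> f S"
    and submodular: "submodular_on M f" and indep: "independence_system M \<I>"
    and A_0: "A 0 \<subseteq> M" and A_Suc: "\<And>r. r < s \<Longrightarrow> A (Suc r) \<subseteq> A r"
    and x_in: "\<And>r. r < s \<Longrightarrow> x r \<in> A r" and l_in: "\<And>r. r < s \<Longrightarrow> l r \<in> Y"
    and pick_indep: "\<And>r. r < s \<Longrightarrow> insert (x r) (Sol r (l r)) \<in> \<I>"
    and Sol_0: "\<And>y. Sol 0 y = {}"
    and Sol_Suc: "\<And>r y. r < s \<Longrightarrow>
          Sol (Suc r) y = (if y = l r then insert (x r) (Sol r y) else Sol r y)"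
    and disjoint: "\<And>r y. r \<le> s \<Longrightarrow> y \<in> Y \<Longrightarrow> A r \<inter> Sol r y = {}"
    and best: "\<And>r z w. \<lbrakk>r < s; z \<in> A r; w \<in> Y; insert z (Sol r w) \<in> \<I>\<rbrakk>
          \<Longrightarrow> marginal f z (Sol r w) \<le> marginal f (x r) (Sol r (l r))"
    and gain_nonneg: "\<And>r. r < s \<Longrightarrow> 0 \<le> marginal f (x r) (Sol r (l r))"
    and stop: "\<And>z w. \<lbrakk>z \<in> A s; w \<in> Y; insert z (Sol s w) \<in> \<I>\<rbrakk> \<Longrightarrow> marginal f z (Sol s w) \<le> 0"
begin

definition gain :: "nat \<Rightarrow> real" where
  "gain r = marginal f (x r) (Sol r (l r))"

section \<open>Monotonicity and telescoping along a run\<close>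

lemma down_closed: "T \<in> \<I> \<Longrightarrow> S \<subseteq> T \<Longrightarrow> S \<in> \<I>"
  using indep by (auto simp: independence_system_def)

lemma indep_subset: "T \<in> \<I> \<Longrightarrow> T \<subseteq> M"
  using indep by (auto simp: independence_system_def)

lemma A_mono: "q \<le> r \<Longrightarrow> r \<le> s \<Longrightarrow> A r \<subseteq> A q"
proof (induction r)
  case (Suc r)
  then show ?case using A_Suc[of r] by (cases "q = Suc r") auto
qed simp

lemma A_subset: "r \<le> s \<Longrightarrow> A r \<subseteq> M"
  using A_mono[of 0 r] A_0 by auto

lemma Sol_mono: "q \<le> r \<Longrightarrow> r \<le> s \<Longrightarrow> Sol q y \<subseteq> Sol r y"
proof (induction r)
  case (Suc r)
  then show ?case using Sol_Suc[of r y] by (cases "q = Suc r") auto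
qed simp

lemma Sol_indep: "r \<le> s \<Longrightarrow> Sol r y \<in> \<I>"
proof (induction r)
  case 0
  then show ?case using indep by (simp add: Sol_0 independence_system_def)
next
  case (Suc r)
  then show ?case using pick_indep by (simp add: Sol_Suc)
qed

lemma Sol_subset: "r \<le> s \<Longrightarrow> Sol r y \<subseteq> M"
  using Sol_indep indep_subset by blast

lemma finite_Sol: "r \<le> s \<Longrightarrow> finite (Sol r y)"
  using Sol_subset finite_M finite_subset by blast

lemma labels_disjoint:
  "r \<le> s \<Longrightarrow> y \<in> Y \<Longrightarrow> w \<in> Y \<Longrightarrow> y \<noteq> w \<Longrightarrow> Sol r y \<inter> Sol r w = {}"
proof (induction r)
  case 0
  then show ?case by (simp add: Sol_0)
next
  case (Suc r)
  then have "x r \<notin> Sol r y" "x r \<notin> Sol r w" "Sol r y \<inter> Sol r w = {}"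
    using x_in[of r] disjoint[of r] by auto
  then show ?case using Suc.prems by (auto simp: Sol_Suc)
qed

text \<open>One turn changes only one solution, so the total telescopes. \<open>g\<close> is
  arbitrary because both \<open>f\<close> and the cardinality are put in its place.\<close>

lemma sum_Sol:
  fixes g :: "'a set \<Rightarrow> real"
  assumes "g {} = 0"
  shows "r \<le> s \<Longrightarrow> (\<Sum>y\<in>Y. g (Sol r y)) = (\<Sum>q<r. marginal g (x q) (Sol q (l q)))"
proof (induction r)
  case 0
  then show ?case using assms by (simp add: Sol_0)
next
  case (Suc r)
  have "(\<Sum>y\<in>Y. g (Sol (Suc r) y))
      = (\<Sum>y\<in>Y. g (Sol r y) + (if y = l r then marginal g (x r) (Sol r (l r)) else 0))"
    using Suc by (intro sum.cong) (auto simp: Sol_Suc marginal_def)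
  also have "\<dots> = (\<Sum>y\<in>Y. g (Sol r y)) + marginal g (x r) (Sol r (l r))"
    using l_in[of r] Suc.prems finite_Y by (simp add: sum.distrib)
  finally show ?case using Suc by simp
qed

lemma sum_value: "(\<Sum>y\<in>Y. f (Sol s y)) = (\<Sum>r<s. gain r)"
  using sum_Sol[of f s] normalized by (simp add: gain_def)

lemma sum_card:
  assumes "r \<le> s"
  shows "(\<Sum>y\<in>Y. real (card (Sol r y))) = real r"
proof -
  have "marginal (\<lambda>S. real (card S)) (x q) (Sol q (l q)) = 1" if "q < r" for q
  proof -
    have "x q \<notin> Sol q (l q)" using that assms x_in[of q] l_in[of q] disjoint[of q] by auto
    then show ?thesis using that assms finite_Sol[of q] by (simp add: marginal_def)
  qed
  then show ?thesis using assms sum_Sol[of "\<lambda>S. real (card S)" r] by simp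
qed

lemma card_Union_Sol:
  assumes "r \<le> s"
  shows "card (\<Union>y\<in>Y. Sol r y) = r"
proof -
  have "card (\<Union>y\<in>Y. Sol r y) = (\<Sum>y\<in>Y. card (Sol r y))"
    using assms finite_Y finite_Sol labels_disjoint by (intro card_UN_disjoint) auto
  then show ?thesis using sum_card[OF assms] by (metis of_nat_eq_iff of_nat_sum)
qed

lemma marginal_Sol_antimono:
  assumes "q \<le> r" "r \<le> s" "z \<in> M" "z \<notin> Sol r y"
  shows "marginal f z (Sol r y) \<le> marginal f z (Sol q y)"
  using assms submodular Sol_mono Sol_subset by (intro marginal_antimono[of M]) auto

text \<open>The next pick, with its label, was already a candidate one turn earlier, and its
  marginal value has not increased since.\<close>

lemma gain_antimono:
  assumes "Suc r < s"
  shows "gain (Suc r) \<le> gain r"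
proof -
  let ?z = "x (Suc r)" and ?w = "l (Suc r)"
  have w: "?w \<in> Y" and z: "?z \<in> A (Suc r)" using assms l_in x_in by auto
  have "insert ?z (Sol r ?w) \<in> \<I>"
    using pick_indep[OF assms] Sol_mono[of r "Suc r" ?w] assms by (auto intro: down_closed)
  then have "marginal f ?z (Sol r ?w) \<le> gain r"
    using best[of r ?z ?w] A_Suc[of r] assms w z by (auto simp: gain_def)
  moreover have "gain (Suc r) \<le> marginal f ?z (Sol r ?w)"
    unfolding gain_def using assms w z disjoint[of "Suc r" ?w] A_subset[of "Suc r"]
    by (intro marginal_Sol_antimono) auto
  ultimately show ?thesis by simp
qed

text \<open>Items of \<open>U\<close> that are no longer candidates for label \<open>y\<close> at turn \<open>r\<close>. Discarding \<open>Sol s y\<close>,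
  rather than \<open>Sol r y\<close>, leaves a set that grows with \<open>r\<close>.\<close>

definition dead :: "'a set \<Rightarrow> nat \<Rightarrow> nat \<Rightarrow> 'a set" where
  "dead U r y = {z \<in> U - Sol s y. \<not> (z \<in> A r \<and> insert z (Sol r y) \<in> \<I>)}"

lemma dead_mono:
  assumes "r < s"
  shows "dead U r y \<subseteq> dead U (Suc r) y"
proof -
  have "insert z (Sol r y) \<in> \<I>" if "insert z (Sol (Suc r) y) \<in> \<I>" for z
    using that Sol_mono[of r "Suc r" y] assms by (auto intro: down_closed)
  then show ?thesis using A_Suc[OF assms] by (auto simp: dead_def)
qed

text \<open>A pair that dies between turns \<open>r\<close> and \<open>Suc r\<close> was a candidate
  at turn \<open>r\<close>, so its marginal value then, and hence at the end, is at most
  \<open>gain r\<close>. This charges \<open>b (Suc r) - b r\<close> pairs to \<open>gain r\<close>,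
  and summation by parts turns the bound on \<open>b\<close> into a bound on the sum.\<close>

lemma sum_marginals_le:
  assumes U: "U \<in> \<I>" "U \<subseteq> A 0"
    and count: "\<And>r. r \<le> s \<Longrightarrow> (\<Sum>y\<in>Y. real (card (dead U r y))) \<le> K * real r"
  shows "(\<Sum>y\<in>Y. \<Sum>z\<in>U - Sol s y. marginal f z (Sol s y)) \<le> K * (\<Sum>y\<in>Y. f (Sol s y))"
proof -
  define b where "b r = (\<Sum>y\<in>Y. real (card (dead U r y)))" for r
  have fin: "finite U" using U finite_M indep_subset finite_subset by blast
  then have fin_dead: "finite (dead U r y)" for r y by (auto simp: dead_def)
  \<comment> \<open>This provides \<open>b 0 = 0\<close>: all of \<open>U\<close> is available at
    the start, and its singletons are independent.\<close>
  have dead_0: "dead U 0 y = {}" for y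
    using U by (auto simp: dead_def Sol_0 intro: down_closed)
  have charged: "(\<Sum>y\<in>Y. \<Sum>z\<in>dead U r y. marginal f z (Sol s y)) \<le> (\<Sum>q<r. (b (Suc q) - b q) * gain q)"
    if "r \<le> s" for r
    using that
  proof (induction r)
    case 0
    then show ?case by (simp add: dead_0)
  next
    case (Suc r)
    have "(\<Sum>z\<in>dead U (Suc r) y. marginal f z (Sol s y))
        \<le> (\<Sum>z\<in>dead U r y. marginal f z (Sol s y))
          + (real (card (dead U (Suc r) y)) - real (card (dead U r y))) * gain r"
      if y: "y \<in> Y" for y
    proof -
      let ?D = "dead U (Suc r) y - dead U r y"
      have sub: "dead U r y \<subseteq> dead U (Suc r) y" using dead_mono Suc.prems by simp
      have "marginal f z (Sol s y) \<le> gain r" if "z \<in> ?D" for z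
      proof -
        have z: "z \<in> A r" "insert z (Sol r y) \<in> \<I>" "z \<notin> Sol s y"
          using that by (auto simp: dead_def)
        have "marginal f z (Sol s y) \<le> marginal f z (Sol r y)"
          using z Suc.prems A_subset[of r] by (intro marginal_Sol_antimono) auto
        also have "\<dots> \<le> gain r" using best z y Suc.prems by (simp add: gain_def)
        finally show ?thesis .
      qed
      then have "(\<Sum>z\<in>?D. marginal f z (Sol s y)) \<le> real (card ?D) * gain r"
        by (intro sum_bounded_above)
      moreover have "real (card ?D) = real (card (dead U (Suc r) y)) - real (card (dead U r y))"
        using sub fin_dead by (simp add: card_Diff_subset card_mono of_nat_diff)
      moreover have "(\<Sum>z\<in>dead U (Suc r) y. marginal f z (Sol s y))
          = (\<Sum>z\<in>?D. marginal f z (Sol s y)) + (\<Sum>z\<in>dead U r y. marginal f z (Sol s y))"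
        using sub fin_dead by (intro sum.subset_diff) auto
      ultimately show ?thesis by simp
    qed
    then have "(\<Sum>y\<in>Y. \<Sum>z\<in>dead U (Suc r) y. marginal f z (Sol s y))
        \<le> (\<Sum>y\<in>Y. (\<Sum>z\<in>dead U r y. marginal f z (Sol s y))
          + (real (card (dead U (Suc r) y)) - real (card (dead U r y))) * gain r)"
      by (intro sum_mono)
    also have "\<dots> = (\<Sum>y\<in>Y. \<Sum>z\<in>dead U r y. marginal f z (Sol s y)) + (b (Suc r) - b r) * gain r"
      by (simp add: b_def sum.distrib flip: sum_subtractf sum_distrib_right)
    finally show ?case using Suc by simp
  qed
  have "(\<Sum>z\<in>U - Sol s y. marginal f z (Sol s y)) \<le> (\<Sum>z\<in>dead U s y. marginal f z (Sol s y))"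
    if "y \<in> Y" for y
  proof -
    \<comment> \<open>A pair that survives to the end is still a candidate there, so
      \<open>stop\<close> applies.\<close>
    have "(\<Sum>z\<in>U - Sol s y - dead U s y. marginal f z (Sol s y)) \<le> 0"
      using stop that by (intro sum_nonpos) (auto simp: dead_def)
    moreover have "dead U s y \<subseteq> U - Sol s y" by (auto simp: dead_def)
    ultimately show ?thesis using fin by (simp add: sum.subset_diff)
  qed
  then have "(\<Sum>y\<in>Y. \<Sum>z\<in>U - Sol s y. marginal f z (Sol s y))
      \<le> (\<Sum>y\<in>Y. \<Sum>z\<in>dead U s y. marginal f z (Sol s y))"
    by (intro sum_mono)
  also have "\<dots> \<le> (\<Sum>r<s. (b (Suc r) - b r) * gain r)" using charged by simp
  also have "\<dots> \<le> K * (\<Sum>r<s. gain r)"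
    using abel_sum_bound[of b s K 0 gain] count gain_nonneg gain_antimono
    by (simp add: b_def dead_0 gain_def)
  finally show ?thesis by (simp add: sum_value)
qed

section \<open>Counting dead pairs\<close>

lemma dead_subset:
  assumes "r \<le> s" "y \<in> Y" "U \<subseteq> A 0"
  shows "dead U r y \<subseteq> (A 0 - A r - (\<Union>w\<in>Y. Sol r w)) \<union> (\<Union>w\<in>Y - {y}. Sol r w)
           \<union> {z \<in> U - Sol r y. insert z (Sol r y) \<notin> \<I>}"
  using assms Sol_mono[of r s y] by (auto simp: dead_def)

text \<open>For a label \<open>y\<close>, other agents account for at most
  \<open>(n - 1) * r\<close> dead items, the other labels for \<open>r - card (Sol r y)\<close>, and
  blocking for \<open>p * card (Sol r y)\<close>. Over all labels the cardinalities add up to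
  \<open>r\<close>, so \<open>- 1 + p\<close> enters once and not once per label.\<close>

lemma count_dead:
  assumes U: "U \<in> \<I>" "U \<subseteq> A 0" and r: "r \<le> s" and n: "n \<ge> 1"
    and stolen: "card (A 0 - A r - (\<Union>y\<in>Y. Sol r y)) \<le> (n - 1) * r"
    and blocked: "\<And>S T. S \<in> \<I> \<Longrightarrow> T \<in> \<I> \<Longrightarrow>
          real (card {z \<in> T - S. insert z S \<notin> \<I>}) \<le> p * real (card S)"
  shows "(\<Sum>y\<in>Y. real (card (dead U r y))) \<le> (real (card Y) * real n - 1 + p) * real r"
proof -
  have fin: "finite U" using U finite_M indep_subset finite_subset by blast
  have finA: "finite (A 0)" using A_0 finite_M finite_subset by blast
  have "real (card (dead U r y)) \<le> (real n * real r - real (card (Sol r y))) + p * real (card (Sol r y))"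
    if y: "y \<in> Y" for y
  proof -
    let ?S = "A 0 - A r - (\<Union>w\<in>Y. Sol r w)" and ?O = "\<Union>w\<in>Y - {y}. Sol r w"
      and ?B = "{z \<in> U - Sol r y. insert z (Sol r y) \<notin> \<I>}"
    have finO: "finite ?O" using finite_Y finite_Sol r by auto
    have "(\<Union>w\<in>Y. Sol r w) = ?O \<union> Sol r y" using y by auto
    moreover have "?O \<inter> Sol r y = {}" using labels_disjoint r y by auto
    ultimately have "card ?O + card (Sol r y) = r"
      using card_Union_Sol[OF r] finO finite_Sol[OF r] by (simp add: card_Un_disjoint)
    then have O: "real (card ?O) = real r - real (card (Sol r y))" by linarith
    have "card (dead U r y) \<le> card (?S \<union> ?O \<union> ?B)"
      using dead_subset[OF r y U(2)] finA finO fin by (intro card_mono) auto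
    also have "\<dots> \<le> card ?S + card ?O + card ?B"
      using card_Un_le[of "?S \<union> ?O" ?B] card_Un_le[of ?S ?O] by linarith
    finally have "real (card (dead U r y)) \<le> real (card ?S) + real (card ?O) + real (card ?B)"
      by linarith
    moreover have "real (card ?S) \<le> real n * real r - real r"
      using of_nat_mono[OF stolen, where 'a=real] n by (simp add: algebra_simps of_nat_diff)
    ultimately show ?thesis using O blocked[OF Sol_indep[OF r] U(1), of y] by simp
  qed
  then have "(\<Sum>y\<in>Y. real (card (dead U r y)))
      \<le> (\<Sum>y\<in>Y. (real n * real r - real (card (Sol r y))) + p * real (card (Sol r y)))"
    by (intro sum_mono)
  also have "\<dots> = (real (card Y) * real n - 1 + p) * real r"
    using sum_card[OF r] by (simp add: sum.distrib sum_subtractf algebra_simps flip: sum_distrib_left)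
  finally show ?thesis .
qed

text \<open>Until the solution is full nothing is blocked and only other agents cause losses; from
  then on \<open>card U \<le> k \<le> r\<close>. The general count with \<open>p = 1\<close> would
  give \<open>K = n\<close>.\<close>

lemma count_dead_cardinality:
  assumes "\<I> = cardinality_constraint M k" and "Y = {y}"
    and U: "U \<in> \<I>" "U \<subseteq> A 0" and r: "r \<le> s"
    and stolen: "card (A 0 - A r - (\<Union>y\<in>Y. Sol r y)) \<le> (n - 1) * r"
  shows "(\<Sum>y\<in>Y. real (card (dead U r y))) \<le> real (max (n - 1) 1) * real r"
proof -
  have fin: "finite U" using U finite_M indep_subset finite_subset by blast
  have finA: "finite (A 0)" using A_0 finite_M finite_subset by blast
  have card: "card (Sol r y) = r" using card_Union_Sol[OF r] assms(2) by simp
  have "card (dead U r y) \<le> max (n - 1) 1 * r"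
  proof (cases "r < k")
    case True
    then have "insert z (Sol r y) \<in> \<I>" if "z \<in> U" for z
      using that card Sol_subset[OF r, of y] U indep_subset[OF U(1)] finite_Sol[OF r, of y] assms(1)
      by (auto simp: cardinality_constraint_def card_insert_if)
    then have "dead U r y \<subseteq> A 0 - A r - (\<Union>y\<in>Y. Sol r y)"
      using dead_subset[OF r _ U(2), of y] assms(2) by auto
    then have "card (dead U r y) \<le> (n - 1) * r"
      using stolen finA card_mono[of "A 0 - A r - (\<Union>y\<in>Y. Sol r y)" "dead U r y"] by simp
    also have "\<dots> \<le> max (n - 1) 1 * r" by (intro mult_right_mono) auto
    finally show ?thesis .
  next
    case False
    have "card (dead U r y) \<le> card U" using fin by (intro card_mono) (auto simp: dead_def)
    also have "\<dots> \<le> 1 * r" using U assms(1) False by (simp add: cardinality_constraint_def)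
    also have "\<dots> \<le> max (n - 1) 1 * r" by (intro mult_right_mono) auto
    finally show ?thesis .
  qed
  then show ?thesis using assms(2) by (simp flip: of_nat_mult)
qed

text \<open>Two solutions make up for the lack of monotonicity: they are disjoint, so
  \<open>U\<close> is the intersection of the sets \<open>U \<union> Sol s y\<close>, and
  submodularity applies, with \<open>f\<close> nonnegative on their union.\<close>

lemma value_le_sum_values:
  assumes Y: "card Y = 1 \<and> mono_on (Pow M) f \<or> card Y = 2" and "U \<subseteq> M"
  shows "f U \<le> (\<Sum>y\<in>Y. f (U \<union> Sol s y))"
  using Y
proof
  assume 1: "card Y = 1 \<and> mono_on (Pow M) f"
  then obtain y where y: "Y = {y}" by (auto simp: card_1_singleton_iff)
  moreover have "f U \<le> f (U \<union> Sol s y)"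
    using 1 assms(2) Sol_subset[of s y] by (intro mono_onD[of "Pow M" f]) auto
  ultimately show ?thesis by simp
next
  assume "card Y = 2"
  then obtain y w where y: "Y = {y, w}" "y \<noteq> w" by (auto simp: card_2_iff)
  let ?S = "U \<union> Sol s y" and ?T = "U \<union> Sol s w"
  have "?S \<subseteq> M" "?T \<subseteq> M" using assms Sol_subset[of s] by auto
  then have "f (?S \<union> ?T) + f (?S \<inter> ?T) \<le> f ?S + f ?T" "0 \<le> f (?S \<union> ?T)"
    using submodular nonneg by (auto simp: submodular_on_def)
  moreover have "?S \<inter> ?T = U" using labels_disjoint[of s y w] y by auto
  ultimately show ?thesis using y by simp
qed

lemma value_le:
  assumes Y: "card Y = 1 \<and> mono_on (Pow M) f \<or> card Y = 2"
    and U: "U \<in> \<I>" "U \<subseteq> A 0"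
    and count: "\<And>r. r \<le> s \<Longrightarrow> (\<Sum>y\<in>Y. real (card (dead U r y))) \<le> K * real r"
    and V: "\<And>y. y \<in> Y \<Longrightarrow> f (Sol s y) \<le> V" and "0 \<le> K"
  shows "f U \<le> (1 + K) * real (card Y) * V"
proof -
  have UM: "U \<subseteq> M" using U indep_subset by blast
  have "f U \<le> (\<Sum>y\<in>Y. f (U \<union> Sol s y))" using value_le_sum_values[OF Y UM] .
  also have "\<dots> \<le> (\<Sum>y\<in>Y. f (Sol s y) + (\<Sum>z\<in>U - Sol s y. marginal f z (Sol s y)))"
    using UM finite_subset[OF UM finite_M] Sol_subset[of s] submodular
    by (intro sum_mono submodular_union_le_sum_marginals[of M]) blast+
  also have "\<dots> \<le> (1 + K) * (\<Sum>y\<in>Y. f (Sol s y))"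
    using sum_marginals_le[OF U count] by (simp add: sum.distrib algebra_simps)
  also have "\<dots> \<le> (1 + K) * (real (card Y) * V)"
    using V assms(6) by (intro mult_left_mono sum_bounded_above) auto
  finally show ?thesis by (simp add: mult.assoc)
qed

text \<open>The first pick is a best available singleton, and right after it one solution consists
  of this item alone. Without a first pick, \<open>stop\<close> at turn 0 gives
  \<open>f {z} \<le> 0\<close>.\<close>

lemma singleton_value_le:
  assumes z: "z \<in> A 0" "{z} \<in> \<I>"
    and V: "\<And>r y. r \<le> s \<Longrightarrow> y \<in> Y \<Longrightarrow> f (Sol r y) \<le> V"
  shows "f {z} \<le> V"
proof -
  obtain y where y: "y \<in> Y" using Y_nonempty by auto
  show ?thesis
  proof (cases "s = 0")
    case True
    then have "f {z} \<le> 0"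
      using stop[of z y] z y normalized by (simp add: Sol_0 marginal_def)
    then show ?thesis using V[of 0 y] y normalized by (simp add: Sol_0)
  next
    case False
    then have "f {z} \<le> f {x 0}"
      using best[of 0 z y] z y normalized by (simp add: Sol_0 marginal_def)
    also have "\<dots> = f (Sol (Suc 0) (l 0))" using False by (simp add: Sol_Suc Sol_0)
    also have "\<dots> \<le> V" using V[of "Suc 0"] l_in[of 0] False by simp
    finally show ?thesis .
  qed
qed

end

section \<open>Independence systems\<close>

lemma finite_indep:
  assumes "independence_system M \<I>" "finite M"
  shows "finite \<I>"
  using assms finite_subset[of \<I> "Pow M"] by (simp add: independence_system_def)

lemma ex_basis_superset:
  assumes "independence_system M \<I>" "finite M" "T \<in> \<I>" "T \<subseteq> S"
  shows "\<exists>B\<in>bases \<I> S. T \<subseteq> B"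
proof -
  have "finite {C \<in> \<I>. C \<subseteq> S}" "T \<in> {C \<in> \<I>. C \<subseteq> S}"
    using finite_indep[OF assms(1,2)] assms by auto
  then obtain B where "B \<in> {C \<in> \<I>. C \<subseteq> S}" "T \<subseteq> B"
    "\<And>C. C \<in> {C \<in> \<I>. C \<subseteq> S} \<Longrightarrow> B \<subseteq> C \<Longrightarrow> C = B"
    by (metis (no_types, lifting) finite_has_maximal2)
  then have "B \<in> bases \<I> S" by (auto simp: bases_def)
  then show ?thesis using \<open>T \<subseteq> B\<close> by blast
qed

lemma p_system_ratio_le:
  assumes "finite M" "p_system M \<I> p" "S \<subseteq> M"
  shows "real (upper_rank \<I> S) / real (lower_rank \<I> S) \<le> p"
proof -
  let ?R = "(\<lambda>S. real (upper_rank \<I> S) / real (lower_rank \<I> S)) ` Pow M"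
  have "real (upper_rank \<I> S) / real (lower_rank \<I> S) \<le> Max ?R"
    using assms by (intro Max_ge imageI) auto
  also have "\<dots> \<le> p" using assms by (simp add: p_system_def)
  finally show ?thesis .
qed

lemma p_system_nonneg:
  assumes "finite M" "p_system M \<I> p"
  shows "0 \<le> p"
proof -
  have "real (upper_rank \<I> {}) / real (lower_rank \<I> {}) \<le> p"
    using p_system_ratio_le[OF assms] by simp
  moreover have "0 \<le> real (upper_rank \<I> {}) / real (lower_rank \<I> {})" by simp
  ultimately show ?thesis by linarith
qed

text \<open>The independent set \<open>S\<close> is a basis of its union with the elements it blocks.\<close>

lemma p_system_card_blocked:
  assumes "finite M" "p_system M \<I> p" and S: "S \<in> \<I>" and T: "T \<in> \<I>"
  shows "real (card {z \<in> T - S. insert z S \<notin> \<I>}) \<le> p * real (card S)"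
proof -
  define D where "D = {z \<in> T - S. insert z S \<notin> \<I>}"
  have ind: "independence_system M \<I>" using assms by (simp add: p_system_def)
  then have down: "\<And>C B. C \<in> \<I> \<Longrightarrow> B \<subseteq> C \<Longrightarrow> B \<in> \<I>" and sub: "\<And>C. C \<in> \<I> \<Longrightarrow> C \<subseteq> M"
    by (auto simp: independence_system_def)
  have D: "D \<in> \<I>" using down[OF T] by (auto simp: D_def)
  have SD: "S \<union> D \<subseteq> M" using sub[OF S] sub[OF D] by auto
  let ?b = "bases \<I> (S \<union> D)"
  have fin: "finite ?b" using finite_indep[OF ind assms(1)] by (simp add: bases_def)
  have finC: "finite C" if "C \<in> \<I>" for C using sub[OF that] assms(1) finite_subset by blast
  have S_basis: "S \<in> ?b"
  proof -
    have "C = S" if C: "C \<in> \<I>" "S \<subseteq> C" "C \<subseteq> S \<union> D" for C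
    proof (rule ccontr)
      assume "C \<noteq> S"
      then obtain z where "z \<in> C" "z \<in> D" "z \<notin> S" using C by blast
      moreover have "insert z S \<in> \<I>" using down[OF C(1)] C(2) \<open>z \<in> C\<close> by auto
      ultimately show False by (simp add: D_def)
    qed
    then show ?thesis using S by (auto simp: bases_def)
  qed
  then have lower: "lower_rank \<I> (S \<union> D) \<le> card S"
    using fin by (simp add: lower_rank_def)
  \<comment> \<open>The blocked items form an independent set; extending it to a basis bounds the
    upper rank from below.\<close>
  obtain B where B: "B \<in> ?b" "D \<subseteq> B"
    using ex_basis_superset[OF ind assms(1) D, of "S \<union> D"] by auto
  have "card D \<le> card B" using B finC by (intro card_mono) (auto simp: bases_def)
  also have "\<dots> \<le> upper_rank \<I> (S \<union> D)" using fin B by (simp add: upper_rank_def)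
  finally have upper: "card D \<le> upper_rank \<I> (S \<union> D)" .
  have ratio: "real (upper_rank \<I> (S \<union> D)) / real (lower_rank \<I> (S \<union> D)) \<le> p"
    using p_system_ratio_le[OF assms(1,2) SD] .
  have "real (card D) \<le> p * real (card S)"
  proof (cases "lower_rank \<I> (S \<union> D) = 0")
    \<comment> \<open>The quotient of the ranks is a division by zero here and carries no
      information. But then the empty set is a maximal independent subset, which forces
      \<open>D = {}\<close>.\<close>
    case True
    moreover have "lower_rank \<I> (S \<union> D) \<in> card ` ?b"
      unfolding lower_rank_def using fin S_basis by (intro Min_in) auto
    ultimately obtain C where C: "C \<in> ?b" "card C = 0" by (metis imageE)
    then have "C = {}" using finC[of C] by (simp add: bases_def)
    then have "D = {}" using C(1) D by (simp add: bases_def)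
    then show ?thesis using p_system_nonneg[OF assms(1,2)] by simp
  next
    case False
    then have "real (upper_rank \<I> (S \<union> D)) \<le> p * real (lower_rank \<I> (S \<union> D))"
      using ratio by (simp add: field_simps)
    also have "\<dots> \<le> p * real (card S)"
      using lower p_system_nonneg[OF assms(1,2)] by (intro mult_left_mono) auto
    finally show ?thesis using upper by linarith
  qed
  then show ?thesis by (simp add: D_def)
qed

lemma cardinality_constraint_indep:
  assumes "finite M"
  shows "independence_system M (cardinality_constraint M k)"
proof -
  have "card T \<le> card S" if "S \<subseteq> M" "T \<subseteq> S" for S T
    using that assms finite_subset card_mono by metis
  then show ?thesis
    unfolding independence_system_def cardinality_constraint_def
    by (auto intro: le_trans)
qed

text \<open>Something is blocked only if \<open>S\<close> has at least \<open>k\<close> elements,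
  hence at least as many as \<open>T\<close>. Thus the counting for systems applies with
  \<open>p = 1\<close>.\<close>

lemma cardinality_constraint_card_blocked:
  assumes "finite M" "S \<in> cardinality_constraint M k" "T \<in> cardinality_constraint M k"
  shows "real (card {z \<in> T - S. insert z S \<notin> cardinality_constraint M k}) \<le> 1 * real (card S)"
proof -
  have fin: "finite S" "finite T"
    using assms finite_subset by (auto simp: cardinality_constraint_def)
  let ?D = "{z \<in> T - S. insert z S \<notin> cardinality_constraint M k}"
  have "card ?D \<le> card S"
  proof (cases "card S < k")
    case True
    then have "?D = {}" using assms fin by (auto simp: cardinality_constraint_def)
    then show ?thesis by (metis card.empty zero_le)
  next
    case False
    have "card ?D \<le> card T" using fin by (intro card_mono) auto
    then show ?thesis using False assms by (simp add: cardinality_constraint_def)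
  qed
  then show ?thesis by simp
qed

section \<open>The protocol as seen by one agent\<close>

lemma concat_replicate_nth:
  "t < T * length xs \<Longrightarrow> concat (replicate T xs) ! t = xs ! (t mod length xs)"
proof (induction T arbitrary: t)
  case 0
  then show ?case by simp
next
  case (Suc T)
  then show ?case by (cases "t < length xs") (simp_all add: nth_append le_mod_geq)
qed

text \<open>An arbitrary list replaces the turn order so that induction can append one turn at a
  time.\<close>

definition history_along ::
    "(nat \<Rightarrow> 'a policy) \<Rightarrow> (nat \<Rightarrow> nat) \<Rightarrow> nat list \<Rightarrow> 'a history" where
  "history_along P \<pi> js = fold (\<lambda>j h. h @ [(j, P j \<pi> h)]) js []"

lemma history_along_snoc:
  "history_along P \<pi> (js @ [j]) = history_along P \<pi> js @ [(j, P j \<pi> (history_along P \<pi> js))]"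
  by (simp add: history_along_def)

lemma length_history_along [simp]: "length (history_along P \<pi> js) = length js"
  by (induction js rule: rev_induct) (simp_all add: history_along_snoc, simp add: history_along_def)

text \<open>Later turns only append, so what the mover saw at time \<open>t\<close> is a prefix of
  the final history.\<close>

lemma nth_history_along:
  "t < length js \<Longrightarrow>
     history_along P \<pi> js ! t = (js ! t, P (js ! t) \<pi> (take t (history_along P \<pi> js)))"
proof (induction js rule: rev_induct)
  case Nil
  then show ?case by simp
next
  case (snoc j js)
  then show ?case by (auto simp: history_along_snoc nth_append less_Suc_eq)
qed

locale round_robin_agent =
  fixes M :: "'a set" and n :: nat and P :: "nat \<Rightarrow> 'a policy" and \<pi> :: "nat \<Rightarrow> nat"
    and i c :: nat and \<I> :: "'a set set" and f :: "'a set \<Rightarrow> real" and Y :: "nat set"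
  assumes finite_M: "finite M" and finite_Y: "finite Y" and Y_nonempty: "Y \<noteq> {}"
    and normalized: "f {} = 0" and nonneg: "\<And>S. S \<subseteq> M \<Longrightarrow> 0 \<le> f S"
    and submodular: "submodular_on M f" and indep: "independence_system M \<I>"
    and perm: "\<pi> permutes {1..n}" and position: "c < n" "\<pi> (Suc c) = i"
    and greedy: "greedy_into Y M \<I> f i (P i)"
begin

abbreviation "h \<equiv> round_robin M n P \<pi>"

definition rounds :: nat where
  "rounds = nat \<lceil>real (card M) / real n\<rceil>"

definition turn :: "nat \<Rightarrow> nat" where
  "turn r = r * n + c"

definition own_move :: "nat \<Rightarrow> 'a move" where
  "own_move r = P i \<pi> (take (turn r) h)"

text \<open>Built from the agent's own moves, so that turn \<open>r\<close> alone separates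
  \<open>sol r\<close> from \<open>sol (Suc r)\<close>; \<open>solution_eq\<close> identifies it
  with the solution recorded by the protocol.\<close>

definition sol :: "nat \<Rightarrow> nat \<Rightarrow> 'a set" where
  "sol r y = {x. \<exists>q<r. own_move q = Some (x, y)}"

section \<open>Times of the agent's turns\<close>

lemma card_M_le: "card M \<le> rounds * n"
proof -
  have "real (card M) / real n \<le> real rounds"
    unfolding rounds_def by (rule real_nat_ceiling_ge)
  then have "real (card M) \<le> real (rounds * n)" using position by (simp add: field_simps)
  then show ?thesis by (simp only: of_nat_le_iff)
qed

lemma length_turn_order: "length (turn_order M n \<pi>) = rounds * n"
  by (simp add: turn_order_def rounds_def length_concat sum_list_replicate)

lemma nth_turn_order: "t < rounds * n \<Longrightarrow> turn_order M n \<pi> ! t = \<pi> (Suc (t mod n))"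
  using position
  by (simp add: turn_order_def rounds_def concat_replicate_nth del: upt_Suc)

lemma round_robin_eq: "h = history_along P \<pi> (turn_order M n \<pi>)"
  by (simp add: round_robin_def history_along_def)

lemma length_h: "length h = rounds * n"
  by (simp add: round_robin_eq length_turn_order)

lemma nth_h:
  "t < rounds * n \<Longrightarrow>
     h ! t = (\<pi> (Suc (t mod n)), P (\<pi> (Suc (t mod n))) \<pi> (take t h))"
  using nth_history_along[of t "turn_order M n \<pi>" P \<pi>]
  by (simp add: round_robin_eq length_turn_order nth_turn_order)

text \<open>Injectivity of \<open>\<pi>\<close> leaves the agent exactly the times congruent to
  \<open>c\<close> modulo \<open>n\<close>.\<close>

lemma agent_iff: "\<pi> (Suc (t mod n)) = i \<longleftrightarrow> t = turn (t div n)"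
proof -
  have "\<pi> (Suc (t mod n)) = i \<longleftrightarrow> t mod n = c"
    using permutes_inj[OF perm] position by (auto dest: injD)
  also have "\<dots> \<longleftrightarrow> t = turn (t div n)"
    using div_mult_mod_eq[of t n] unfolding turn_def by linarith
  finally show ?thesis .
qed

lemma turn_less_iff: "turn q < turn r \<longleftrightarrow> q < r"
  using position by (simp add: turn_def)

lemma turn_less_rounds: "q < rounds \<Longrightarrow> turn q < rounds * n"
proof -
  assume "q < rounds"
  then have "Suc q * n \<le> rounds * n" by (intro mult_le_mono1) simp
  then show "turn q < rounds * n" using position by (simp add: turn_def)
qed

lemma turn_div: "turn q div n = q"
  using position by (simp add: turn_def)

lemma nth_h_turn: "q < rounds \<Longrightarrow> h ! turn q = (i, own_move q)"
  using nth_h[OF turn_less_rounds] agent_iff[of "turn q"] by (simp add: turn_div own_move_def)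

lemma in_set_take_h:
  "e \<in> set (take u h) \<longleftrightarrow> (\<exists>t<u. t < rounds * n \<and> e = h ! t)"
  by (auto simp: in_set_conv_nth length_h)

lemma solution_eq:
  assumes "r \<le> rounds"
  shows "solution i y (take (turn r) h) = sol r y"
proof (intro set_eqI iffI)
  fix x assume "x \<in> solution i y (take (turn r) h)"
  then obtain t where t: "t < turn r" "t < rounds * n" "h ! t = (i, Some (x, y))"
    by (auto simp: solution_def in_set_take_h)
  then have eq: "t = turn (t div n)" using nth_h[OF t(2)] agent_iff by auto
  then have "t div n < r" using t(1) turn_less_iff by metis
  then show "x \<in> sol r y" using nth_h_turn[of "t div n"] t(3) eq assms by (auto simp: sol_def)
next
  fix x assume "x \<in> sol r y"
  then obtain q where q: "q < r" "own_move q = Some (x, y)" by (auto simp: sol_def)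
  then have "turn q < turn r" "turn q < rounds * n" "h ! turn q = (i, Some (x, y))"
    using assms turn_less_rounds nth_h_turn by (auto simp: turn_less_iff)
  then show "x \<in> solution i y (take (turn r) h)"
    unfolding solution_def in_set_take_h by (metis (mono_tags, lifting) mem_Collect_eq)
qed

text \<open>Once the protocol is over nothing counts as available. This makes the bound on stolen items
  hold at the end as well: the \<open>\<lceil>m / n\<rceil>\<close> rounds leave at most \<open>m - r \<le> (n - 1) r\<close> items
  outside the solutions if the agent picked in all \<open>r\<close> of them.\<close>

definition avail :: "nat \<Rightarrow> 'a set" where
  "avail r = (if r < rounds then available M (take (turn r) h) else {})"

lemma candidates_eq:
  "r < rounds \<Longrightarrow> candidates M \<I> Y i (take (turn r) h)
     = {(z, w). z \<in> avail r \<and> w \<in> Y \<and> insert z (sol r w) \<in> \<I>}"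
  by (simp add: candidates_def avail_def solution_eq)

lemma own_move_None:
  assumes "r < rounds" "own_move r = None" "z \<in> avail r" "w \<in> Y"
  shows "insert z (sol r w) \<notin> \<I>"
proof -
  have "candidates M \<I> Y i (take (turn r) h) = {}"
    using greedy assms(2) unfolding greedy_into_def own_move_def by (metis option.distinct(1))
  then show ?thesis using assms by (auto simp: candidates_eq)
qed

lemma own_move_Some:
  assumes "r < rounds" "own_move r = Some (z, w)"
  shows "z \<in> avail r" "w \<in> Y" "insert z (sol r w) \<in> \<I>"
    and "\<And>z' w'. \<lbrakk>z' \<in> avail r; w' \<in> Y; insert z' (sol r w') \<in> \<I>\<rbrakk>
           \<Longrightarrow> marginal f z' (sol r w') \<le> marginal f z (sol r w)"
proof -
  let ?C = "candidates M \<I> Y i (take (turn r) h)"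
  have "?C \<noteq> {}"
    using greedy assms(2) unfolding greedy_into_def own_move_def by (metis option.distinct(1))
  then have "is_arg_max (\<lambda>(x, y). marginal f x (solution i y (take (turn r) h))) (\<lambda>c. c \<in> ?C) (z, w)"
    using greedy assms(2) unfolding greedy_into_def own_move_def by (metis option.inject)
  then have *: "(z, w) \<in> ?C" "\<And>z' w'. (z', w') \<in> ?C
      \<Longrightarrow> marginal f z' (sol r w') \<le> marginal f z (sol r w)"
    using assms(1) by (auto simp: is_arg_max_linorder solution_eq)
  show "z \<in> avail r" "w \<in> Y" "insert z (sol r w) \<in> \<I>"
    using *(1) candidates_eq[OF assms(1)] by auto
  show "marginal f z' (sol r w') \<le> marginal f z (sol r w)"
    if "z' \<in> avail r" "w' \<in> Y" "insert z' (sol r w') \<in> \<I>" for z' w'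
    using *(2) candidates_eq[OF assms(1)] that by auto
qed

lemma avail_antimono: "q \<le> r \<Longrightarrow> avail r \<subseteq> avail q"
proof -
  assume "q \<le> r"
  then have "turn q \<le> turn r" using position by (simp add: turn_def)
  then have "set (take (turn q) h) \<subseteq> set (take (turn r) h)" by (rule set_take_subset_set_take)
  then show ?thesis using \<open>q \<le> r\<close> by (auto simp: avail_def available_def)
qed

lemma avail_sol_disjoint: "r \<le> rounds \<Longrightarrow> avail r \<inter> sol r y = {}"
  by (auto simp: avail_def available_def solution_def simp flip: solution_eq)

section \<open>Cutting the run off before the first negative gain\<close>

definition picks :: "nat \<Rightarrow> bool" where
  "picks r \<longleftrightarrow> r < rounds \<and>
     (\<exists>z w. own_move r = Some (z, w) \<and> 0 \<le> marginal f z (sol r w))"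

text \<open>The minimum exists because \<open>picks rounds\<close> is false.\<close>

definition stop_round :: nat where
  "stop_round = (LEAST r. \<not> picks r)"

definition item :: "nat \<Rightarrow> 'a" where
  "item r = fst (the (own_move r))"

definition label :: "nat \<Rightarrow> nat" where
  "label r = snd (the (own_move r))"

lemma stop_round_le: "stop_round \<le> rounds"
  unfolding stop_round_def by (rule Least_le) (simp add: picks_def)

lemma not_picks_stop_round: "\<not> picks stop_round"
  unfolding stop_round_def by (rule LeastI[of _ rounds]) (simp add: picks_def)

lemma before_stop_round:
  assumes "r < stop_round"
  shows "r < rounds" "own_move r = Some (item r, label r)"
    and "0 \<le> marginal f (item r) (sol r (label r))"
proof -
  have "picks r" using not_less_Least[of r "\<lambda>r. \<not> picks r"] assms by (auto simp: stop_round_def)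
  then show "r < rounds" "own_move r = Some (item r, label r)"
    "0 \<le> marginal f (item r) (sol r (label r))"
    by (auto simp: picks_def item_def label_def)
qed

text \<open>There are three ways to stop: the protocol is over and nothing is available; the agent
  passes, so there are no candidates; or its best candidate has negative marginal value.\<close>

lemma at_stop_round:
  assumes "z \<in> avail stop_round" "w \<in> Y" "insert z (sol stop_round w) \<in> \<I>"
  shows "marginal f z (sol stop_round w) \<le> 0"
proof -
  have lt: "stop_round < rounds" using assms(1) by (auto simp: avail_def split: if_splits)
  show ?thesis
  proof (cases "own_move stop_round")
    case None
    then show ?thesis using own_move_None lt assms by blast
  next
    case (Some m)
    obtain z' w' where m: "own_move stop_round = Some (z', w')" using Some by (cases m) auto
    then have "marginal f z' (sol stop_round w') < 0"
      using not_picks_stop_round lt by (auto simp: picks_def not_le)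
    moreover have "marginal f z (sol stop_round w) \<le> marginal f z' (sol stop_round w')"
      using own_move_Some(4)[OF lt m] assms by blast
    ultimately show ?thesis by simp
  qed
qed

sublocale greedy_run M \<I> f Y avail sol item label stop_round
proof
  show "avail 0 \<subseteq> M" by (auto simp: avail_def available_def)
  show "avail (Suc r) \<subseteq> avail r" for r by (simp add: avail_antimono)
  show "sol 0 y = {}" for y by (simp add: sol_def)
  show "avail r \<inter> sol r y = {}" if "r \<le> stop_round" for r y
    using that stop_round_le by (simp add: avail_sol_disjoint)
  show "marginal f z (sol stop_round w) \<le> 0"
    if "z \<in> avail stop_round" "w \<in> Y" "insert z (sol stop_round w) \<in> \<I>" for z w
    using at_stop_round that .
  fix r assume "r < stop_round"
  note r = before_stop_round[OF this]
  show "item r \<in> avail r" "label r \<in> Y" "insert (item r) (sol r (label r)) \<in> \<I>"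
    using own_move_Some[OF r(1,2)] by auto
  show "0 \<le> marginal f (item r) (sol r (label r))" using r(3) .
  show "sol (Suc r) y = (if y = label r then insert (item r) (sol r y) else sol r y)" for y
    using r(2) by (auto simp: sol_def less_Suc_eq)
  show "marginal f z (sol r w) \<le> marginal f (item r) (sol r (label r))"
    if "z \<in> avail r" "w \<in> Y" "insert z (sol r w) \<in> \<I>" for z w
    using own_move_Some(4)[OF r(1,2)] that by auto
qed (use finite_M finite_Y Y_nonempty normalized nonneg submodular indep in auto)

text \<open>From time \<open>turn 0\<close> to just before \<open>turn r\<close> the other agents
  make \<open>(n - 1) * r\<close> moves, each of which takes at most one item.\<close>

lemma card_stolen:
  assumes "r \<le> stop_round"
  shows "card (avail 0 - avail r - (\<Union>y\<in>Y. sol r y)) \<le> (n - 1) * r"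
proof (cases "r < rounds")
  case False
  then have r: "r = rounds" "r = stop_round" using assms stop_round_le by auto
  have sub: "(\<Union>y\<in>Y. sol r y) \<subseteq> M" using Sol_subset assms by auto
  have "card (avail 0 - avail r - (\<Union>y\<in>Y. sol r y)) \<le> card (M - (\<Union>y\<in>Y. sol r y))"
    using A_0 finite_M by (intro card_mono) auto
  also have "\<dots> = card M - r"
    using sub finite_M card_Union_Sol[OF assms] by (simp add: card_Diff_subset finite_subset)
  also have "\<dots> \<le> (n - 1) * r" using card_M_le r by (simp add: algebra_simps diff_mult_distrib)
  finally show ?thesis .
next
  case True
  define W where "W = {turn 0..<turn r} - turn ` {..<r}"
  have inj: "inj_on turn {..<r}"
    by (metis inj_onI turn_div)
  have "turn ` {..<r} \<subseteq> {turn 0..<turn r}"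
    using turn_less_iff[of _ r] by (fastforce simp: turn_def)
  then have "card W = (turn r - turn 0) - r"
    unfolding W_def using inj by (simp add: card_Diff_subset card_image)
  also have "\<dots> = (n - 1) * r" by (simp add: turn_def algebra_simps diff_mult_distrib)
  finally have card_W: "card W = (n - 1) * r" .
  \<comment> \<open>The map sends a time to the item selected then. Its unspecified values at passes
    are harmless, since every stolen item comes from a \<open>Some\<close> move.\<close>
  have "avail 0 - avail r - (\<Union>y\<in>Y. sol r y) \<subseteq> (\<lambda>t. fst (the (snd (h ! t)))) ` W"
  proof
    fix x assume x: "x \<in> avail 0 - avail r - (\<Union>y\<in>Y. sol r y)"
    then have x0: "x \<in> available M (take (turn 0) h)" and "x \<notin> available M (take (turn r) h)"
      using True by (auto simp: avail_def split: if_splits)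
    then obtain j y where "(j, Some (x, y)) \<in> set (take (turn r) h)"
      by (auto simp: available_def)
    then obtain t where t: "t < turn r" "t < rounds * n" "h ! t = (j, Some (x, y))"
      by (auto simp: in_set_take_h)
    have "\<not> t < turn 0"
      using x0 t by (fastforce simp: available_def in_set_take_h)
    \<comment> \<open>A move of the agent itself would have put the item into a solution with a
      label in \<open>Y\<close>.\<close>
    moreover have "t \<notin> turn ` {..<r}"
    proof
      assume "t \<in> turn ` {..<r}"
      then obtain q where q: "q < r" "t = turn q" by auto
      then have m: "own_move q = Some (x, y)" using nth_h_turn[of q] t True by auto
      then have "y \<in> Y" using own_move_Some(2)[of q] q True by auto
      then show False using x m q by (auto simp: sol_def)
    qed
    ultimately have "t \<in> W" using t by (simp add: W_def)
    then show "x \<in> (\<lambda>t. fst (the (snd (h ! t)))) ` W" using t by (intro image_eqI) auto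
  qed
  then have "card (avail 0 - avail r - (\<Union>y\<in>Y. sol r y)) \<le> card W"
    using surj_card_le[of W] by (simp add: W_def)
  then show ?thesis by (simp add: card_W)
qed

lemma card_lost: "card (M - avail 0) \<le> c"
proof (cases "rounds = 0")
  \<comment> \<open>\<open>avail 0\<close> is empty by convention here, but without rounds there are
    no items to lose.\<close>
  case True
  then have "M = {}" using card_M_le finite_M by simp
  then show ?thesis by simp
next
  case False
  have "M - avail 0 \<subseteq> (\<lambda>t. fst (the (snd (h ! t)))) ` {..<c}"
  proof
    fix x assume "x \<in> M - avail 0"
    then obtain j y where "(j, Some (x, y)) \<in> set (take (turn 0) h)"
      using False by (auto simp: avail_def available_def)
    then obtain t where t: "t < turn 0" "h ! t = (j, Some (x, y))"
      by (auto simp: in_set_take_h)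
    then show "x \<in> (\<lambda>t. fst (the (snd (h ! t)))) ` {..<c}"
      by (intro image_eqI[of _ _ t]) (auto simp: turn_def)
  qed
  then show ?thesis using surj_card_le[of "{..<c}"] by simp
qed

section \<open>Bounds on the obtained value for a fixed permutation\<close>

lemma sol_le_obtained_value:
  assumes "r \<le> stop_round" "y \<in> Y"
  shows "f (sol r y) \<le> obtained_value Y f i h"
proof -
  let ?V = "{f (solution i y (take t h)) | y t. y \<in> Y \<and> t \<le> length h}"
  have "?V = (\<lambda>(y, t). f (solution i y (take t h))) ` (Y \<times> {..length h})" by auto
  then have fin: "finite ?V" using finite_Y by simp
  \<comment> \<open>For \<open>r = rounds\<close> the time \<open>turn r\<close> may exceed the
    length of the history, whereas \<open>obtained_value\<close> only looks at prefix lengths up to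
    it.\<close>
  have "sol r y = solution i y (take (min (turn r) (length h)) h)"
    using solution_eq[of r y] assms stop_round_le by (cases "turn r \<le> length h") auto
  moreover have "min (turn r) (length h) \<le> length h" by simp
  ultimately have "\<exists>y' t. f (sol r y) = f (solution i y' (take t h)) \<and> y' \<in> Y \<and> t \<le> length h"
    using assms(2) by metis
  then have "f (sol r y) \<in> ?V" by simp
  with fin show ?thesis unfolding obtained_value_def by (rule Max_ge)
qed

lemma obtained_value_nonneg: "0 \<le> obtained_value Y f i h"
  using sol_le_obtained_value[of 0] Y_nonempty normalized by (auto simp: Sol_0)

lemma available_singleton_le:
  "z \<in> avail 0 \<Longrightarrow> {z} \<in> \<I> \<Longrightarrow> f {z} \<le> obtained_value Y f i h"
  using singleton_value_le sol_le_obtained_value by blast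

text \<open>The two alternatives for \<open>K\<close> are those of \<open>count_dead\<close> and
  \<open>count_dead_cardinality\<close>; keeping them in one hypothesis lets the averaging be done
  once.\<close>

lemma available_part_le:
  assumes Y: "card Y = 1 \<and> mono_on (Pow M) f \<or> card Y = 2"
    and U: "U \<in> \<I>" "U \<subseteq> avail 0" and K: "0 \<le> K"
    and cases: "K = real (card Y) * real n - 1 + p \<and>
        (\<forall>S\<in>\<I>. \<forall>T\<in>\<I>. real (card {z \<in> T - S. insert z S \<notin> \<I>}) \<le> p * real (card S))
      \<or> K = real (max (n - 1) 1) \<and> card Y = 1 \<and> \<I> = cardinality_constraint M k"
  shows "f U \<le> (1 + K) * real (card Y) * obtained_value Y f i h"
proof (rule value_le[OF Y U])
  fix r assume r: "r \<le> stop_round"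
  have n: "n \<ge> 1" using position by simp
  from cases show "(\<Sum>y\<in>Y. real (card (dead U r y))) \<le> K * real r"
  proof
    assume "K = real (card Y) * real n - 1 + p \<and>
        (\<forall>S\<in>\<I>. \<forall>T\<in>\<I>. real (card {z \<in> T - S. insert z S \<notin> \<I>}) \<le> p * real (card S))"
    then show ?thesis using count_dead[OF U r n card_stolen[OF r], of p] by blast
  next
    assume *: "K = real (max (n - 1) 1) \<and> card Y = 1 \<and> \<I> = cardinality_constraint M k"
    then obtain y where "Y = {y}" by (auto simp: card_1_singleton_iff)
    then show ?thesis using count_dead_cardinality[OF _ _ U r card_stolen[OF r]] * by blast
  qed
qed (use sol_le_obtained_value K in auto)

end

section \<open>Averaging over the permutation\<close>

text \<open>Padding with zeros makes \<open>a\<close> meaningful at every index, however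
  \<open>n\<close> compares with \<open>card D\<close>; nonnegativity of \<open>g\<close> keeps the
  padded sequence decreasing.\<close>

lemma descending_enumeration:
  fixes g :: "'a \<Rightarrow> real"
  assumes "finite D" "\<And>x. x \<in> D \<Longrightarrow> 0 \<le> g x"
  obtains e :: "nat \<Rightarrow> 'a" and a :: "nat \<Rightarrow> real"
  where "bij_betw e {..<card D} D" "antimono a" "\<And>j. 0 \<le> a j"
    and "\<And>j. j < card D \<Longrightarrow> a j = g (e j)" "\<And>j. card D \<le> j \<Longrightarrow> a j = 0"
proof -
  obtain ys where ys: "set ys = D" "distinct ys"
    using finite_distinct_list[OF assms(1)] by auto
  define zs where "zs = sort_key (\<lambda>x. - g x) ys"
  have zs: "set zs = D" "distinct zs" "length zs = card D"
    using ys distinct_card[of ys] by (auto simp: zs_def)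
  define a where "a j = (if j < card D then g (zs ! j) else 0)" for j
  have "sorted (map (\<lambda>x. - g x) zs)" by (simp add: zs_def)
  then have "g (zs ! k) \<le> g (zs ! j)" if "j \<le> k" "k < card D" for j k
    using sorted_nth_mono[of "map (\<lambda>x. - g x) zs" j k] that zs by simp
  moreover have nonneg: "0 \<le> g (zs ! j)" if "j < card D" for j
    using that zs assms(2) nth_mem by metis
  ultimately have "antimono a" by (auto simp: antimono_def a_def)
  moreover have "bij_betw ((!) zs) {..<card D} D" using zs by (intro bij_betw_nth) auto
  moreover have "0 \<le> a j" for j using nonneg by (simp add: a_def)
  ultimately show ?thesis using that[of "(!) zs" a] by (simp add: a_def)
qed

context round_robin_agent
begin

lemma optimum_bounds:
  assumes Y: "card Y = 1 \<and> mono_on (Pow M) f \<or> card Y = 2"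
    and D: "D \<in> \<I>" and K: "0 \<le> K"
    and cases: "K = real (card Y) * real n - 1 + p \<and>
        (\<forall>S\<in>\<I>. \<forall>T\<in>\<I>. real (card {z \<in> T - S. insert z S \<notin> \<I>}) \<le> p * real (card S))
      \<or> K = real (max (n - 1) 1) \<and> card Y = 1 \<and> \<I> = cardinality_constraint M k"
    and e: "bij_betw e {..<card D} D" and a: "antimono a" "\<And>j. 0 \<le> a j"
    and a_e: "\<And>j. j < card D \<Longrightarrow> a j = f {e j}" and a_0: "\<And>j. card D \<le> j \<Longrightarrow> a j = 0"
  shows "f D \<le> (1 + K) * real (card Y) * obtained_value Y f i h + (\<Sum>j<n - 1. a j)"
    and "a c \<le> obtained_value Y f i h"
proof -
  have DM: "D \<subseteq> M" using indep_subset D by blast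
  then have fin: "finite D" using finite_M finite_subset by blast
  define L where "L = D - avail 0"
  define J where "J = {j. j < card D \<and> e j \<in> L}"
  have finJ: "finite J" by (simp add: J_def)
  have eJ: "bij_betw e J L"
    using e unfolding bij_betw_def J_def L_def by (auto intro: inj_on_subset)
  have "card L \<le> card (M - avail 0)"
    using DM finite_M by (intro card_mono) (auto simp: L_def)
  then have cardJ: "card J \<le> c" using card_lost bij_betw_same_card[OF eJ] by linarith
  have split: "(D \<inter> avail 0) \<union> L = D" "(D \<inter> avail 0) \<inter> L = {}" by (auto simp: L_def)
  have sub: "D \<inter> avail 0 \<subseteq> M" "L \<subseteq> M" using DM by (auto simp: L_def)
  have "f D \<le> f (D \<inter> avail 0) + f L"
    using submodular sub split normalized unfolding submodular_on_def by (metis add.right_neutral)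
  moreover have "f (D \<inter> avail 0) \<le> (1 + K) * real (card Y) * obtained_value Y f i h"
    using D by (intro available_part_le[OF Y _ _ K cases]) (auto intro: down_closed)
  moreover have "f L \<le> (\<Sum>z\<in>L. f {z})"
    using submodular normalized fin sub
    by (intro submodular_le_sum_singletons[of M]) (auto simp: L_def)
  moreover have "(\<Sum>z\<in>L. f {z}) = sum a J"
    using sum.reindex_bij_betw[OF eJ, of "\<lambda>z. f {z}"] a_e by (simp add: J_def)
  moreover have "sum a J \<le> sum a {..<card J}" using sum_le_sum_initial_segment[OF finJ a(1)] .
  \<comment> \<open>\<open>card J \<le> c \<le> n - 1\<close>, and the added terms are
    nonnegative.\<close>
  moreover have "sum a {..<card J} \<le> sum a {..<n - 1}"
    using cardJ position a by (intro sum_mono2) auto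
  ultimately show "f D \<le> (1 + K) * real (card Y) * obtained_value Y f i h + (\<Sum>j<n - 1. a j)"
    by linarith
  show "a c \<le> obtained_value Y f i h"
  proof (cases "c < card D")
    case True
    \<comment> \<open>At most \<open>c\<close> of the \<open>c + 1\<close> most valuable items of
      \<open>D\<close> are lost, so one of them is still available at the first turn.\<close>
    have "\<not> {..c} \<subseteq> J" using cardJ card_mono[OF finJ, of "{..c}"] by auto
    then obtain j where j: "j \<le> c" "j \<notin> J" by auto
    then have "e j \<in> avail 0" "e j \<in> D"
      using True e by (auto simp: J_def L_def bij_betw_def)
    then have "f {e j} \<le> obtained_value Y f i h"
      using D by (intro available_singleton_le) (auto intro: down_closed)
    moreover have "a c \<le> a j" using j a(1) by (simp add: antimono_def)
    ultimately show ?thesis using a_e[of j] j True by simp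
  next
    case False
    then show ?thesis using a_0 obtained_value_nonneg by simp
  qed
qed

end

text \<open>The position of \<open>i\<close> is uniform: inverting all permutations and composing
  with the transposition of \<open>i\<close> and \<open>k\<close> turns the sum into that of
  \<open>g (\<pi> k)\<close>. Summed over \<open>k\<close>, each \<open>\<pi>\<close> merely
  rearranges the values of \<open>g\<close> on \<open>S\<close>.\<close>

lemma sum_permutes_inv:
  fixes g :: "'b \<Rightarrow> real"
  assumes "finite S" "i \<in> S"
  shows "real (card S) * (\<Sum>\<pi> | \<pi> permutes S. g (inv \<pi> i))
    = real (card {\<pi>. \<pi> permutes S}) * (\<Sum>k\<in>S. g k)"
proof -
  have "(\<Sum>\<pi> | \<pi> permutes S. g (inv \<pi> i)) = (\<Sum>\<pi> | \<pi> permutes S. g (\<pi> k))" if "k \<in> S" for k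
  proof -
    have "(\<Sum>\<pi> | \<pi> permutes S. g (inv \<pi> i)) = (\<Sum>\<pi> | \<pi> permutes S. g (\<pi> i))"
      by (rule sum_permutations_inverse[symmetric])
    also have "\<dots> = (\<Sum>\<pi> | \<pi> permutes S. g ((\<pi> \<circ> Transposition.transpose i k) i))"
      using assms that
      by (intro sum_permutations_compose_right[of "Transposition.transpose i k" S "\<lambda>\<pi>. g (\<pi> i)"] permutes_swap_id)
    finally show ?thesis by simp
  qed
  then have "(\<Sum>k\<in>S. \<Sum>\<pi> | \<pi> permutes S. g (inv \<pi> i))
      = (\<Sum>k\<in>S. \<Sum>\<pi> | \<pi> permutes S. g (\<pi> k))"
    by (rule sum.cong[OF refl])
  also have "\<dots> = (\<Sum>\<pi> | \<pi> permutes S. \<Sum>k\<in>S. g (\<pi> k))" by (rule sum.swap)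
  also have "\<dots> = (\<Sum>\<pi> | \<pi> permutes S. \<Sum>k\<in>S. g k)"
    using sum.reindex_bij_betw[OF permutes_imp_bij, of _ S g] by simp
  finally show ?thesis by simp
qed

section \<open>The bound in expectation\<close>

lemma OPT_attained:
  assumes "finite M" "independence_system M \<I>"
  obtains D where "D \<in> \<I>" "f D = OPT \<I> f"
proof -
  have "OPT \<I> f \<in> f ` \<I>"
    unfolding OPT_def using assms finite_indep by (intro Max_in) (auto simp: independence_system_def)
  then show ?thesis using that by (metis imageE)
qed

lemma expected_value_bound:
  fixes M :: "'a set" and P :: "nat \<Rightarrow> 'a policy" and f :: "'a set \<Rightarrow> real"
  defines "Y \<equiv> labels M f"
  assumes finite_M: "finite M" and i: "i \<in> {1..n}"
    and f: "f {} = 0" "\<And>S. S \<subseteq> M \<Longrightarrow> f S \<ge> 0" "submodular_on M f"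
    and greedy: "chooses_greedily M \<I> f i (P i)"
    and indep: "independence_system M \<I>" and K: "0 \<le> K"
    and cases: "K = real (card Y) * real n - 1 + p \<and>
        (\<forall>S\<in>\<I>. \<forall>T\<in>\<I>. real (card {z \<in> T - S. insert z S \<notin> \<I>}) \<le> p * real (card S))
      \<or> K = real (max (n - 1) 1) \<and> card Y = 1 \<and> \<I> = cardinality_constraint M k"
  shows "OPT \<I> f \<le> ((1 + K) * real (card Y) + (if n = 1 then 0 else real n)) * expected_value M n P f i"
    and "0 \<le> expected_value M n P f i"
proof -
  define Perms where "Perms = {\<pi>. \<pi> permutes {1..n}}"
  define v where "v \<pi> = obtained_value Y f i (round_robin M n P \<pi>)" for \<pi>
  define E where "E = expected_value M n P f i"
  have Perms: "finite Perms" "Perms \<noteq> {}"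
    using finite_permutations[of "{1..n}"] permutes_id[of "{1..n}"] unfolding Perms_def by blast+
  then have card_Perms: "0 < real (card Perms)" by (simp add: card_gt_0_iff)
  \<comment> \<open>Expectations are handled as sums over all permutations, without
    division.\<close>
  have E: "real (card Perms) * E = (\<Sum>\<pi>\<in>Perms. v \<pi>)"
    using Perms card_Perms
    unfolding E_def expected_value_def v_def Y_def Perms_def[symmetric]
    by (simp add: integral_pmf_of_set)
  have Y: "card Y = 1 \<and> mono_on (Pow M) f \<or> card Y = 2" "finite Y" "Y \<noteq> {}"
    by (auto simp: Y_def labels_def)
  have agent: "round_robin_agent M n P \<pi> i (inv \<pi> i - 1) \<I> f Y" if "\<pi> \<in> Perms" for \<pi>
  proof -
    have \<pi>: "\<pi> permutes {1..n}" using that by (simp add: Perms_def)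
    then have "inv \<pi> i \<in> {1..n}" using i permutes_in_image[OF permutes_inv] by metis
    moreover have "\<pi> (inv \<pi> i) = i" using \<pi> permutes_inverses(1) by metis
    ultimately show ?thesis
      using finite_M Y f indep \<pi> greedy
      by unfold_locales (auto simp: chooses_greedily_def Y_def)
  qed
  have v_nonneg: "0 \<le> v \<pi>" if "\<pi> \<in> Perms" for \<pi>
    unfolding v_def using round_robin_agent.obtained_value_nonneg[OF agent[OF that]] .
  have "0 \<le> real (card Perms) * E" unfolding E using v_nonneg by (intro sum_nonneg)
  then show "0 \<le> expected_value M n P f i"
    using card_Perms by (simp add: E_def zero_le_mult_iff)
  obtain D where D: "D \<in> \<I>" "f D = OPT \<I> f" using OPT_attained[OF finite_M indep] .
  have DM: "D \<subseteq> M" using D indep by (auto simp: independence_system_def)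
  obtain e a where e: "bij_betw e {..<card D} D" "antimono a" "\<And>j. 0 \<le> a j"
      "\<And>j. j < card D \<Longrightarrow> a j = f {e j}" "\<And>j. card D \<le> j \<Longrightarrow> a j = 0"
    using descending_enumeration[of D "\<lambda>z. f {z}"] finite_subset[OF DM finite_M] f(2) DM
    by (smt (verit) empty_subsetI insert_subset subsetD)
  have opt: "OPT \<I> f \<le> (1 + K) * real (card Y) * v \<pi> + (\<Sum>j<n - 1. a j)"
    and a_v: "a (inv \<pi> i - 1) \<le> v \<pi>" if "\<pi> \<in> Perms" for \<pi>
    using round_robin_agent.optimum_bounds[OF agent[OF that] Y(1) D(1) K cases e] D(2)
    by (simp_all add: v_def)
  have "real (card Perms) * OPT \<I> f = (\<Sum>\<pi>\<in>Perms. OPT \<I> f)" by simp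
  also have "\<dots> \<le> (\<Sum>\<pi>\<in>Perms. (1 + K) * real (card Y) * v \<pi> + (\<Sum>j<n - 1. a j))"
    using opt by (intro sum_mono)
  also have "\<dots> = (1 + K) * real (card Y) * (\<Sum>\<pi>\<in>Perms. v \<pi>) + real (card Perms) * (\<Sum>j<n - 1. a j)"
    by (simp add: sum.distrib sum_distrib_left)
  also have "\<dots> = real (card Perms) * ((1 + K) * real (card Y) * E + (\<Sum>j<n - 1. a j))"
    by (simp add: algebra_simps flip: E)
  finally have 1: "OPT \<I> f \<le> (1 + K) * real (card Y) * E + (\<Sum>j<n - 1. a j)"
    using card_Perms by simp
  \<comment> \<open>The agent's position counted from 0 is \<open>inv \<pi> i - 1\<close>, so
    averaging over permutations runs uniformly through \<open>a 0\<close> to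
    \<open>a (n - 1)\<close>.\<close>
  have "real (card Perms) * (\<Sum>j<n. a j) = real (card Perms) * (\<Sum>k\<in>{1..n}. a (k - 1))"
    by (simp add: sum.atLeast1_atMost_eq)
  also have "\<dots> = real n * (\<Sum>\<pi>\<in>Perms. a (inv \<pi> i - 1))"
    using sum_permutes_inv[of "{1..n}" i "\<lambda>k. a (k - 1)"] i by (simp add: Perms_def)
  also have "\<dots> \<le> real n * (\<Sum>\<pi>\<in>Perms. v \<pi>)"
    using a_v by (intro mult_left_mono sum_mono) auto
  also have "\<dots> = real (card Perms) * (real n * E)" by (simp flip: E)
  finally have "(\<Sum>j<n. a j) \<le> real n * E" using card_Perms by simp
  moreover have "(\<Sum>j<n - 1. a j) \<le> (\<Sum>j<n. a j)" using e(3) by (intro sum_mono2) auto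
  \<comment> \<open>For \<open>n = 1\<close> the sum on the left is empty; a cardinality constraint
    needs this saving to reach the factor 2 there.\<close>
  ultimately have "(\<Sum>j<n - 1. a j) \<le> (if n = 1 then 0 else real n) * E" by simp
  then show "OPT \<I> f \<le> ((1 + K) * real (card Y) + (if n = 1 then 0 else real n)) * expected_value M n P f i"
    using 1 by (simp add: E_def distrib_right)
qed

theorem theorem10:
  fixes M :: "'a set" and n i :: nat
    and f :: "'a set \<Rightarrow> real" and \<I> :: "'a set set"
    and P :: "nat \<Rightarrow> 'a policy"
  assumes "finite M" and "n \<ge> 1" and "i \<in> {1..n}"
    and "f {} = 0"
    and "\<And>S. S \<subseteq> M \<Longrightarrow> f S \<ge> 0"
    and "submodular_on M f"
    and "\<And>j. j \<in> {1..n} - {i} \<Longrightarrow> legal_policy M (P j)"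
    and "chooses_greedily M \<I> f i (P i)"
  shows
    "(\<forall>p::real. p_system M \<I> p \<and> mono_on (Pow M) f \<longrightarrow>
        expected_value M n P f i \<ge> OPT \<I> f / ((2 + p / real n) * real n)) \<and>
     (\<forall>k::nat. \<I> = cardinality_constraint M k \<and> mono_on (Pow M) f \<longrightarrow>
        expected_value M n P f i \<ge> OPT \<I> f / (2 * real n)) \<and>
     (\<forall>p::real. p_system M \<I> p \<and> \<not> mono_on (Pow M) f \<longrightarrow>
        expected_value M n P f i \<ge> OPT \<I> f / ((5 + (4 * p + 2) / real n) * real n)) \<and>
     (\<forall>k::nat. \<I> = cardinality_constraint M k \<and> \<not> mono_on (Pow M) f \<longrightarrow>
        expected_value M n P f i \<ge> OPT \<I> f / ((5 + 2 / real n) * real n))"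
proof -
  have n: "real n \<ge> 1" using assms(2) by simp
  let ?E = "expected_value M n P f i" and ?q = "real (card (labels M f))"
  let ?blocked = "\<lambda>p. \<forall>S\<in>\<I>. \<forall>T\<in>\<I>. real (card {z \<in> T - S. insert z S \<notin> \<I>}) \<le> p * real (card S)"
  have bound: "OPT \<I> f / d \<le> ?E"
    if "independence_system M \<I>" "0 \<le> K"
      and "K = ?q * real n - 1 + p \<and> ?blocked p
        \<or> K = real (max (n - 1) 1) \<and> card (labels M f) = 1 \<and> \<I> = cardinality_constraint M k"
      and d: "(1 + K) * ?q + (if n = 1 then 0 else real n) \<le> d" "0 < d"
    for K d p :: real and k
  proof -
    note b = expected_value_bound[where M = M and n = n and f = f and i = i and P = P, OF assms(1,3-6,8) that(1-3)]
    \<comment> \<open>The factor may be enlarged to \<open>d\<close> because the expectation is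
      nonnegative.\<close>
    have "OPT \<I> f \<le> d * ?E" using b(1) mult_right_mono[OF d(1) b(2)] by linarith
    then show ?thesis using d(2) by (simp add: divide_le_eq mult.commute)
  qed
  have p_bound: "OPT \<I> f / d \<le> ?E"
    if "independence_system M \<I>" "?blocked p" "0 \<le> p"
      and d: "(?q * real n + p) * ?q + real n \<le> d" for p d :: real
  proof (rule bound[of "?q * real n - 1 + p" p 0 d])
    have q: "1 \<le> ?q" by (simp add: labels_def)
    then have "1 \<le> ?q * real n" using n mult_mono[of 1 ?q 1 "real n"] by simp
    then show "0 \<le> ?q * real n - 1 + p" using that(3) by simp
    have "0 \<le> (?q * real n + p) * ?q" using that(3) by simp
    then show "0 < d" using d n by linarith
    show "(1 + (?q * real n - 1 + p)) * ?q + (if n = 1 then 0 else real n) \<le> d"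
    proof -
      have "1 + (?q * real n - 1 + p) = ?q * real n + p" by simp
      moreover have "(if n = 1 then 0 else real n) \<le> real n" by simp
      ultimately show ?thesis using d by (metis add_left_mono order_trans)
    qed
  qed (use that in auto)
  have p_system: "independence_system M \<I>" "?blocked p" "0 \<le> p" if "p_system M \<I> p" for p
    using that p_system_card_blocked[OF assms(1) that] p_system_nonneg[OF assms(1) that]
    by (simp_all add: p_system_def)
  have card_system: "independence_system M \<I>" "?blocked 1"
    if "\<I> = cardinality_constraint M k" for k
    using that cardinality_constraint_indep[of M k] cardinality_constraint_card_blocked[of M _ k]
      assms(1) by auto
  show ?thesis
  proof (intro conjI allI impI; elim conjE)
    fix p assume p: "p_system M \<I> p" "mono_on (Pow M) f"
    \<comment> \<open>With one label the factor is \<open>(n + p) + n\<close>.\<close>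
    show "OPT \<I> f / ((2 + p / real n) * real n) \<le> ?E"
      using p n by (intro p_bound[OF p_system[OF p(1)]]) (simp add: labels_def field_simps)
  next
    fix k assume k: "\<I> = cardinality_constraint M k" "mono_on (Pow M) f"
    \<comment> \<open>For \<open>n \<ge> 2\<close> the factor is \<open>(1 + (n - 1)) + n\<close>;
      for \<open>n = 1\<close> it is \<open>(1 + 1) + 0\<close>.\<close>
    show "OPT \<I> f / (2 * real n) \<le> ?E"
      using k n
      by (intro bound[of "real (max (n - 1) 1)" 0 k] card_system[OF k(1)])
        (auto simp: labels_def max_def of_nat_diff)
  next
    fix p assume p: "p_system M \<I> p" "\<not> mono_on (Pow M) f"
    \<comment> \<open>With two labels the factor is
      \<open>2 * (2 * n + p) + n = 5 * n + 2 * p\<close>, which is at most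
      \<open>5 * n + 4 * p + 2\<close>.\<close>
    show "OPT \<I> f / ((5 + (4 * p + 2) / real n) * real n) \<le> ?E"
      using p n p_system(3)[OF p(1)]
      by (intro p_bound[OF p_system[OF p(1)]]) (simp add: labels_def field_simps)
  next
    fix k assume k: "\<I> = cardinality_constraint M k" "\<not> mono_on (Pow M) f"
    \<comment> \<open>The same factor with \<open>p = 1\<close>, which is
      \<open>5 * n + 2\<close>.\<close>
    show "OPT \<I> f / ((5 + 2 / real n) * real n) \<le> ?E"
      using k n by (intro p_bound[OF card_system[OF k(1)]]) (simp_all add: labels_def field_simps)
  qed
qed

end
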